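(* Let $n,d\geq 1$, let $P(\lambda)=A_0+A_1\lambda+\dots+A_d\lambda^d$ be a matrix polynomial of degree $d$ with $A_j\in\mathbb{C}^{n\times n}$, and let $\zeta_1,\dots,\zeta_{nd}$ be its eigenvalues, arranged by non-decreasing modulus. Let $\|\cdot\|$ be any norm on $\mathbb{C}^{n\times n}$ satisfying (A1), assume $\det A_0\neq 0$, and let $c=\frac{|\det A_0|}{\|A_0\|^n}$. Let $\alpha_1\leq\dots\leq\alpha_d$ be the tropical roots of $\mathsf{t}p(x)=\max_{0\leq j\leq d}\|A_j\|x^j$, and for $K\in\{1,\dots,nd\}$ let $\bar\alpha_K=\alpha_{\lceil K/n\rceil}$. Let $\operatorname{mon}P$ denote the number of nonzero monomials of $P$ (the number of $j\in\{0,\dots,d\}$ with $A_j\neq 0$). Then, for all $K\in\{1,\dots,nd\}$, $$\frac{|\zeta_1\cdots\zeta_K|}{\bar\alpha_1\cdots\bar\alpha_K}\geq c\,(L_{K/n})^n ,$$ and in particular, for all integers $1\leq k\leq d$, $$\frac{|\zeta_1\cdots\zeta_{nk}|}{(\alpha_1\cdots\alpha_k)^n}\geq c\,(L_k)^n ,$$ where, for $0<k\leq d$, $L_k=\frac{1}{\operatorname{mon}P}$. Moreover, when $\|\cdot\|$ satisfies (A2), these inequalities hold with the greater constant $L_k=\frac{1}{\sqrt{\operatorname{mon}P}}$.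
   Context: (A1): $|\det A|\leq\|A\|^n$ for all $A\in\mathbb{C}^{n\times n}$. (A2): there exist $Q,Q'\in\mathbb{C}^{n\times n}$ with $\det Q=\det Q'=1$ and $\|QAQ'\|_{\mathrm{nF}}\leq\|A\|$ for all $A\in\mathbb{C}^{n\times n}$, where $\|A\|_{\mathrm{nF}}=\big(\frac1n\sum_{i,j=1}^n|A_{ij}|^2\big)^{1/2}$ is the normalized Frobenius norm. Degree $d$ means $A_d\neq0$. The eigenvalues of $P$ are the roots of the polynomial $\det P(\lambda)$ counted with multiplicities; if $\det P$ has degree less than $nd$, the list is completed to $nd$ entries by infinite eigenvalues, whose modulus is $+\infty$. The tropical roots of $\mathsf{t}p$ are the unique numbers $0\leq\alpha_1\leq\dots\leq\alpha_d$ such that $\mathsf{t}p(x)=\|A_d\|\prod_{j=1}^d\max(x,\alpha_j)$ for all $x\geq0$. They are all positive when $A_0\neq0$. $\lceil x\rceil$ is the least integer $\geq x$. *)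

theory Defs
  imports "HOL-Analysis.Analysis" "HOL-Computational_Algebra.Polynomial"
begin

text \<open>
  A matrix polynomial is an element of \<open>(complex^'n^'n) poly\<close>, with \<open>coeff P j\<close> the
  matrix coefficient of the \<open>j\<close>-th power. The multiplication of type \<open>complex^'n^'n\<close> is
  componentwise, so \<open>poly P z\<close> must not be used to evaluate \<open>P\<close>; only \<open>coeff\<close> and
  \<open>degree\<close> are used below.
\<close>

definition matrix_scale :: "complex \<Rightarrow> complex^'n^'n \<Rightarrow> complex^'n^'n" where
  "matrix_scale z A = (\<chi> i j. z * A $ i $ j)"

definition is_matrix_norm :: "(complex^'n^'n \<Rightarrow> real) \<Rightarrow> bool" where
  "is_matrix_norm N \<longleftrightarrow>
     (\<forall>A. N A \<ge> 0) \<and>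
     (\<forall>A. N A = 0 \<longleftrightarrow> A = 0) \<and>
     (\<forall>z A. N (matrix_scale z A) = cmod z * N A) \<and>
     (\<forall>A B. N (A + B) \<le> N A + N B)"

definition normalized_frobenius :: "complex^'n^'n \<Rightarrow> real" where
  "normalized_frobenius A =
     sqrt (1 / real CARD('n) * (\<Sum>i\<in>UNIV. \<Sum>j\<in>UNIV. (cmod (A $ i $ j))\<^sup>2))"

definition norm_A1 :: "(complex^'n^'n \<Rightarrow> real) \<Rightarrow> bool" where
  "norm_A1 N \<longleftrightarrow> (\<forall>A. cmod (det A) \<le> N A ^ CARD('n))"

definition norm_A2 :: "(complex^'n^'n \<Rightarrow> real) \<Rightarrow> bool" where
  "norm_A2 N \<longleftrightarrow>
     (\<exists>Q Q'. det Q = 1 \<and> det Q' = 1 \<and> (\<forall>A. normalized_frobenius (Q ** A ** Q') \<le> N A))"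

definition det_matpoly :: "(complex^'n^'n) poly \<Rightarrow> complex poly" where
  "det_matpoly P = det (\<chi> i j. map_poly (\<lambda>A. A $ i $ j) P)"

lemma poly_det_matpoly:
  fixes P :: "(complex^'n^'n) poly"
  shows "poly (det_matpoly P) z = det (\<Sum>j\<le>degree P. matrix_scale (z ^ j) (coeff P j))"
proof -
  have entry: "poly (map_poly (\<lambda>A. A $ i $ j) P) z
      = (\<Sum>k\<le>degree P. matrix_scale (z ^ k) (coeff P k)) $ i $ j" for i j :: 'n
  proof -
    have le: "degree (map_poly (\<lambda>A. A $ i $ j) P) \<le> degree P"
      by (rule degree_le) (simp add: coeff_map_poly coeff_eq_0)
    have "poly (map_poly (\<lambda>A. A $ i $ j) P) z
        = (\<Sum>k\<le>degree P. coeff (map_poly (\<lambda>A. A $ i $ j) P) k * z ^ k)"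
      unfolding poly_altdef
      by (rule sum.mono_neutral_left) (use le in \<open>auto simp: coeff_eq_0\<close>)
    then show ?thesis
      by (simp add: coeff_map_poly matrix_scale_def mult.commute)
  qed
  show ?thesis
    unfolding det_matpoly_def det_def
    by (simp add: poly_sum poly_prod entry)
qed

text \<open>
  Eigenvalues with multiplicity: \<open>Some z\<close> is a finite eigenvalue, \<open>None\<close> the infinite one.
  Meaningful only when \<open>det_matpoly P\<close> is nonzero.
\<close>

definition eigenvalues_matpoly :: "(complex^'n^'n) poly \<Rightarrow> complex option multiset" where
  "eigenvalues_matpoly P =
     image_mset Some (proots (det_matpoly P)) +
     replicate_mset (CARD('n) * degree P - degree (det_matpoly P)) None"

definition modulus :: "complex option \<Rightarrow> ereal" where
  "modulus \<zeta> = (case \<zeta> of None \<Rightarrow> \<infinity> | Some z \<Rightarrow> ereal (cmod z))"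

text \<open>Eigenvalues and tropical roots are listed from index \<open>1\<close>; other indices are irrelevant.\<close>

definition eigenvalue_listing ::
    "(complex^'n^'n) poly \<Rightarrow> (nat \<Rightarrow> complex option) \<Rightarrow> bool" where
  "eigenvalue_listing P \<zeta> \<longleftrightarrow>
     image_mset \<zeta> (mset_set {1..CARD('n) * degree P}) = eigenvalues_matpoly P \<and>
     mono_on {1..CARD('n) * degree P} (\<lambda>i. modulus (\<zeta> i))"

definition tropical_poly ::
    "(complex^'n^'n \<Rightarrow> real) \<Rightarrow> (complex^'n^'n) poly \<Rightarrow> real \<Rightarrow> real" where
  "tropical_poly N P x = Max ((\<lambda>j. N (coeff P j) * x ^ j) ` {0..degree P})"

definition is_tropical_roots ::
    "(complex^'n^'n \<Rightarrow> real) \<Rightarrow> (complex^'n^'n) poly \<Rightarrow> (nat \<Rightarrow> real) \<Rightarrow> bool" where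
  "is_tropical_roots N P \<alpha> \<longleftrightarrow>
     (\<forall>j\<in>{1..degree P}. 0 \<le> \<alpha> j) \<and>
     mono_on {1..degree P} \<alpha> \<and>
     (\<forall>x\<ge>0. tropical_poly N P x =
        N (coeff P (degree P)) * (\<Prod>j=1..degree P. max x (\<alpha> j)))"

definition mon :: "(complex^'n^'n) poly \<Rightarrow> nat" where
  "mon P = card {j \<in> {0..degree P}. coeff P j \<noteq> 0}"

end

theory Submission
  imports Defs "HOL-Computational_Algebra.Fundamental_Theorem_Algebra"
begin

text \<open>
  Write \<open>p = det P\<close>. By Jensen's formula, the geometric mean of \<open>\<bar>p\<bar>\<close> over the circle of radius \<open>r\<close> is
  \<open>\<bar>det A\<^sub>0\<bar>\<close> times the product of the numbers \<open>max 1 (r / \<bar>\<zeta>\<bar>)\<close> over all eigenvalues \<open>\<zeta>\<close>, and hence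
  at least \<open>\<bar>det A\<^sub>0\<bar> r\<^sup>K / \<bar>\<zeta>\<^sub>1 \<dots> \<zeta>\<^sub>K\<bar>\<close>. An upper bound on that mean is therefore a lower bound on
  the product of eigenvalues (Landau's inequality, \<open>landau_inequality\<close>).

  The mean is at most \<open>(L tp(r))\<^sup>n\<close> with \<open>L = mon P\<close> or \<open>L = sqrt (mon P)\<close>. Under (A1) already
  \<open>\<bar>p\<bar> \<le> \<parallel>P\<parallel>\<^sup>n\<close> holds pointwise, and the triangle inequality bounds \<open>\<parallel>P\<parallel>\<close> by \<open>mon P\<close> terms, each at most
  \<open>tp(r)\<close> (\<open>prod_det_matpoly_le_A1\<close>). Under (A2), Hadamard's inequality gives
  \<open>\<bar>p\<bar> \<le> \<parallel>Q P Q'\<parallel>\<^sup>n\<close> in the normalized Frobenius norm. The geometric mean of the square of this norm is at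
  most its arithmetic mean, and that is a sum of squares by Parseval's identity; this gains the square
  root (\<open>prod_det_matpoly_le_A2\<close>).

  Finally \<open>r\<close> is chosen as the tropical root \<open>\<alpha>\<^sub>m\<close> with \<open>m = \<lceil>K/n\<rceil>\<close>, where
  \<open>tp(r) \<alpha>\<^sub>1 \<dots> \<alpha>\<^sub>m = \<parallel>A\<^sub>0\<parallel> r\<^sup>m\<close>; all powers of \<open>r\<close> then cancel (\<open>eigenvalue_product_bound\<close>).

  No integral is used: the mean over the circle is replaced by the one over \<open>r w\<close>, where \<open>w\<close> runs
  through the \<open>M\<close>-th roots of unity. There Parseval's identity is exact for \<open>M > d\<close>, Jensen's formula
  becomes the factorization of \<open>1 - x\<^sup>M\<close>, and what remains is the limit \<open>M \<rightarrow> \<infinity>\<close>.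
\<close>

section \<open>Hadamard's inequality\<close>

text \<open>
  The library's inner product on \<^typ>\<open>complex^'n\<close> is the real part of this form. The complex
  value is needed because row operations subtract complex multiples of rows.
\<close>
definition hermitian_inner :: "complex^'n \<Rightarrow> complex^'n \<Rightarrow> complex" where
  "hermitian_inner x y = (\<Sum>j\<in>UNIV. x $ j * cnj (y $ j))"

lemma hermitian_inner_self: "hermitian_inner x x = of_real ((norm x)\<^sup>2)"
  by (simp add: hermitian_inner_def norm_vec_def L2_set_def sum_nonneg complex_norm_square
      flip: of_real_power)

lemma hermitian_inner_add_left:
  "hermitian_inner (x + y) z = hermitian_inner x z + hermitian_inner y z"
  by (simp add: hermitian_inner_def algebra_simps sum.distrib)

lemma hermitian_inner_diff_left:
  "hermitian_inner (x - y) z = hermitian_inner x z - hermitian_inner y z"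
  by (simp add: hermitian_inner_def algebra_simps sum_subtractf)

lemma hermitian_inner_scale_left:
  "hermitian_inner (c *s x) z = c * hermitian_inner x z"
  by (simp add: hermitian_inner_def sum_distrib_left mult.assoc)

lemma hermitian_inner_sum_left:
  "hermitian_inner (\<Sum>k\<in>S. f k) z = (\<Sum>k\<in>S. hermitian_inner (f k) z)"
  by (induction S rule: infinite_finite_induct)
     (simp_all add: hermitian_inner_add_left, simp_all add: hermitian_inner_def)

lemma hermitian_inner_commute: "hermitian_inner y x = cnj (hermitian_inner x y)"
  by (simp add: hermitian_inner_def mult.commute)

lemma norm_le_of_hermitian_orthogonal:
  assumes "hermitian_inner u v = 0"
  shows "norm u \<le> norm (u + v)"
proof -
  have vu: "hermitian_inner v u = 0"
    using assms hermitian_inner_commute[of v u] by simp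
  have "hermitian_inner (u + v) (u + v) = cnj (hermitian_inner u (u + v)) + cnj (hermitian_inner v (u + v))"
    by (metis complex_cnj_add hermitian_inner_add_left hermitian_inner_commute)
  also have "\<dots> = hermitian_inner u u + hermitian_inner v v"
    using assms vu by (simp add: hermitian_inner_add_left flip: hermitian_inner_commute)
  finally have "complex_of_real ((norm (u + v))\<^sup>2) = of_real ((norm u)\<^sup>2 + (norm v)\<^sup>2)"
    by (simp only: hermitian_inner_self of_real_add)
  then have "(norm (u + v))\<^sup>2 = (norm u)\<^sup>2 + (norm v)\<^sup>2"
    by (simp only: of_real_eq_iff)
  then show ?thesis
    using power2_le_imp_le[of "norm u" "norm (u + v)"] by simp
qed

text \<open>
  Gram--Schmidt without normalization. Subtracting from row \<open>a\<close> its projections onto already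
  orthogonal rows changes neither the determinant nor the other rows, and it cannot
  lengthen row \<open>a\<close>.
\<close>
lemma gram_schmidt_rows:
  fixes A :: "complex^'n^'n"
  assumes "finite S"
  shows "\<exists>B. det B = det A \<and> (\<forall>i. norm (B $ i) \<le> norm (A $ i)) \<and> (\<forall>i. i \<notin> S \<longrightarrow> B $ i = A $ i) \<and>
    (\<forall>i\<in>S. \<forall>j\<in>S. i \<noteq> j \<longrightarrow> hermitian_inner (B $ i) (B $ j) = 0)"
  using assms
proof (induction S)
  case empty
  show ?case by auto
next
  case (insert a S)
  then obtain B where B: "det B = det A" "\<And>i. norm (B $ i) \<le> norm (A $ i)"
    "\<And>i. i \<notin> S \<Longrightarrow> B $ i = A $ i"
    "\<And>i j. i \<in> S \<Longrightarrow> j \<in> S \<Longrightarrow> i \<noteq> j \<Longrightarrow> hermitian_inner (B $ i) (B $ j) = 0"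
    by blast
  \<comment> \<open>If row \<open>k\<close> is zero, this is \<open>x / 0 = 0\<close>; any other coefficient would do as well.\<close>
  define q where "q k = hermitian_inner (B $ a) (B $ k) / hermitian_inner (B $ k) (B $ k)" for k
  define v where "v = (\<Sum>k\<in>S. q k *s B $ k)"
  define B' where "B' = (\<chi> k. if k = a then B $ a - v else B $ k)"
  have row: "row k B = B $ k" for k
    by (simp add: row_def vec_eq_iff)
  have orth: "hermitian_inner (B $ a - v) (B $ l) = 0" if l: "l \<in> S" for l
  proof -
    have "hermitian_inner v (B $ l) = (\<Sum>k\<in>S. q k * hermitian_inner (B $ k) (B $ l))"
      by (simp add: v_def hermitian_inner_sum_left hermitian_inner_scale_left)
    also have "\<dots> = (\<Sum>k\<in>S. if k = l then q l * hermitian_inner (B $ l) (B $ l) else 0)"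
      by (intro sum.cong) (use B(4) l in auto)
    also have "\<dots> = q l * hermitian_inner (B $ l) (B $ l)"
      using l insert.hyps by simp
    also have "\<dots> = hermitian_inner (B $ a) (B $ l)"
    proof (cases "B $ l = 0")
      case True
      then show ?thesis by (simp add: hermitian_inner_def)
    next
      case False
      then have "hermitian_inner (B $ l) (B $ l) \<noteq> 0"
        by (simp add: hermitian_inner_self)
      then show ?thesis by (simp add: q_def)
    qed
    finally show ?thesis by (simp add: hermitian_inner_diff_left)
  qed
  have orth': "hermitian_inner (B $ l) (B $ a - v) = 0" if "l \<in> S" for l
    unfolding hermitian_inner_commute[of "B $ l" "B $ a - v"] orth[OF that] by simp
  have "hermitian_inner v (B $ a - v) = 0"
  proof -
    have "hermitian_inner (\<Sum>k\<in>S. q k *s B $ k) (B $ a - v) = 0"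
      unfolding hermitian_inner_sum_left hermitian_inner_scale_left
      by (intro sum.neutral ballI) (simp add: orth')
    then show ?thesis by (simp only: v_def)
  qed
  then have "norm (B $ a - v) \<le> norm (B $ a - v + v)"
    by (intro norm_le_of_hermitian_orthogonal) (subst hermitian_inner_commute, simp)
  then have nrm: "norm (B $ a - v) \<le> norm (A $ a)"
    using B(2)[of a] by simp
  have span: "- v \<in> vec.span {row j B | j. j \<noteq> a}"
    unfolding v_def
    by (intro vec.span_neg vec.span_sum vec.span_scale vec.span_base)
       (use insert.hyps row in auto)
  have "det B' = det B"
    using det_row_span[OF span] by (simp add: B'_def row cong: if_cong)
  moreover have "hermitian_inner (B' $ i) (B' $ j) = 0"
    if "i \<in> insert a S" "j \<in> insert a S" "i \<noteq> j" for i j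
  proof (cases "i = a \<or> j = a")
    case True
    then show ?thesis using that orth orth' by (auto simp: B'_def)
  next
    case False
    then show ?thesis using that B(4)[of i j] by (simp add: B'_def)
  qed
  moreover have "norm (B' $ i) \<le> norm (A $ i)" for i
    using nrm B(2) by (simp add: B'_def)
  moreover have "B' $ i = A $ i" if "i \<notin> insert a S" for i
    using that B(3) by (simp add: B'_def)
  ultimately show ?case
    by (intro exI[of _ B'] conjI allI ballI impI) (simp_all only: B(1))
qed

lemma det_cnj_transpose:
  fixes A :: "complex^'n^'n"
  shows "det (\<chi> i j. cnj (A $ j $ i)) = cnj (det A)"
proof -
  have "det (\<chi> i j. cnj (A $ j $ i)) = det (transpose (\<chi> i j. cnj (A $ i $ j)))"
    by (simp add: transpose_def)
  also have "\<dots> = cnj (det A)"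
    by (simp add: det_transpose) (simp add: det_def)
  finally show ?thesis .
qed

text \<open>
  After orthogonalizing the rows, the Gram matrix \<open>B B\<^sup>*\<close> is diagonal, so the square of \<open>\<bar>det B\<bar>\<close> is
  the product of the squared row norms, which are at most the original ones.
\<close>
theorem hadamard_inequality:
  fixes A :: "complex^'n^'n"
  shows "cmod (det A) \<le> (\<Prod>i\<in>UNIV. norm (A $ i))"
proof -
  obtain B where B: "det B = det A" "\<And>i. norm (B $ i) \<le> norm (A $ i)"
    "\<And>i j. i \<noteq> j \<Longrightarrow> hermitian_inner (B $ i) (B $ j) = 0"
    using gram_schmidt_rows[of "UNIV :: 'n set" A] by auto
  define G where "G = B ** (\<chi> i j. cnj (B $ j $ i))"
  have G: "G $ i $ j = hermitian_inner (B $ i) (B $ j)" for i j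
    by (simp add: G_def matrix_matrix_mult_def hermitian_inner_def)
  have "complex_of_real ((cmod (det A))\<^sup>2) = det G"
    unfolding G_def det_mul det_cnj_transpose B(1) by (rule complex_norm_square)
  also have "\<dots> = (\<Prod>i\<in>UNIV. G $ i $ i)"
    by (rule det_diagonal) (simp add: G B(3))
  also have "\<dots> = of_real ((\<Prod>i\<in>UNIV. norm (B $ i))\<^sup>2)"
    by (simp add: G hermitian_inner_self prod_power_distrib)
  finally have "(cmod (det A))\<^sup>2 = (\<Prod>i\<in>UNIV. norm (B $ i))\<^sup>2"
    by (simp only: of_real_eq_iff)
  then have "cmod (det A) = (\<Prod>i\<in>UNIV. norm (B $ i))"
    by (rule power2_eq_imp_eq) (auto intro: prod_nonneg)
  also have "\<dots> \<le> (\<Prod>i\<in>UNIV. norm (A $ i))"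
    by (rule prod_mono) (use B(2) in auto)
  finally show ?thesis .
qed

lemma prod_le_power_mean:
  fixes f :: "'a \<Rightarrow> real"
  assumes "finite S" "S \<noteq> {}" "\<And>i. i \<in> S \<Longrightarrow> 0 \<le> f i"
  shows "(\<Prod>i\<in>S. f i) \<le> ((\<Sum>i\<in>S. f i) / card S) ^ card S"
proof -
  have card: "card S > 0" using assms by (simp add: card_gt_0_iff)
  have "(\<Prod>i\<in>S. f i) = ((\<Prod>i\<in>S. f i) powr (1 / card S)) ^ card S"
  proof (cases "(\<Prod>i\<in>S. f i) = 0")
    case False
    then show ?thesis using card assms(3) by (simp add: powr_power prod_nonneg)
  qed (use card in simp)
  also have "\<dots> \<le> (\<Sum>i\<in>S. f i / card S) ^ card S"
    using arith_geom_mean[OF assms] by (intro power_mono) auto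
  finally show ?thesis by (simp add: sum_divide_distrib)
qed

lemma normalized_frobenius_square:
  fixes A :: "complex^'n^'n"
  shows "(normalized_frobenius A)\<^sup>2 = (\<Sum>i\<in>UNIV. \<Sum>j\<in>UNIV. (cmod (A $ i $ j))\<^sup>2) / CARD('n)"
  by (simp add: normalized_frobenius_def sum_nonneg)

text \<open>
  Hadamard's inequality followed by the inequality between geometric and arithmetic means for the
  squared norms of the \<open>n\<close> rows; the factor \<open>1/n\<close> in the normalized norm is the one of the mean.
\<close>
lemma det_le_normalized_frobenius:
  fixes A :: "complex^'n^'n"
  shows "(cmod (det A))\<^sup>2 \<le> ((normalized_frobenius A)\<^sup>2) ^ CARD('n)"
proof -
  have "(cmod (det A))\<^sup>2 \<le> (\<Prod>i\<in>UNIV. norm (A $ i))\<^sup>2"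
    by (rule power_mono[OF hadamard_inequality]) simp
  also have "\<dots> = (\<Prod>i\<in>UNIV. (norm (A $ i))\<^sup>2)"
    by (simp add: prod_power_distrib)
  also have "\<dots> \<le> ((\<Sum>i\<in>UNIV. (norm (A $ i))\<^sup>2) / CARD('n)) ^ CARD('n)"
    by (rule prod_le_power_mean) auto
  also have "(\<Sum>i\<in>UNIV. (norm (A $ i))\<^sup>2) / CARD('n) = (normalized_frobenius A)\<^sup>2"
    by (simp add: normalized_frobenius_square norm_vec_def L2_set_def sum_nonneg)
  finally show ?thesis .
qed

section \<open>Products and sums over roots of unity\<close>

lemma prod_diff_roots_unity:
  fixes x :: complex
  assumes "M > 0"
  shows "(\<Prod>z | z ^ M = 1. x - z) = x ^ M - 1"
proof -
  define q :: "complex poly" where "q = monom 1 M - 1"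
  have q: "poly q z = z ^ M - 1" for z
    by (simp add: q_def poly_monom)
  have "rsquarefree q"
    unfolding rsquarefree_roots using assms
    by (auto simp: q q_def pderiv_diff pderiv_monom poly_monom power_0_left)
  moreover have "lead_coeff q = 1"
  proof -
    have "degree q = M"
      unfolding q_def using assms degree_add_eq_left[of "-1::complex poly" "monom 1 M"] by (simp add: degree_monom_eq)
    then show ?thesis using assms by (simp add: q_def)
  qed
  ultimately have "(\<Prod>z | poly q z = 0. [:-z, 1:]) = q"
    using complex_poly_decompose_rsquarefree[of q] by simp
  then have "poly (\<Prod>z | poly q z = 0. [:-z, 1:]) x = poly q x"
    by simp
  then show ?thesis by (simp add: q poly_prod)
qed

lemma prod_one_minus_roots_unity:
  fixes w :: complex
  assumes "M > 0"
  shows "(\<Prod>z | z ^ M = 1. 1 - w * z) = 1 - w ^ M"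
proof (cases "w = 0")
  case True
  then show ?thesis using assms by simp
next
  case False
  have "(\<Prod>z | z ^ M = 1. 1 - w * z) = (\<Prod>z | z ^ M = 1. w * (1 / w - z))"
    using False by (simp add: algebra_simps)
  also have "\<dots> = w ^ M * ((1 / w) ^ M - 1)"
    using assms by (simp add: prod.distrib card_roots_unity_eq prod_diff_roots_unity)
  also have "\<dots> = 1 - w ^ M"
    using False by (simp add: field_simps)
  finally show ?thesis .
qed

text \<open>
  Multiplication by a primitive \<open>M\<close>-th root of unity \<open>w\<close> permutes the summation range and multiplies
  the sum by \<open>w\<^sup>j\<close> times the conjugate of \<open>w\<^sup>l\<close>, which differs from \<open>1\<close>.
\<close>
lemma sum_roots_unity_orthogonal:
  assumes "j < M" "l < M" "j \<noteq> l"
  shows "(\<Sum>z | z ^ M = 1. z ^ j * cnj (z ^ l)) = (0 :: complex)"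
proof -
  have M: "M > 0" using assms by simp
  define w where "w = cis (2 * pi / M)"
  have pow: "w ^ k = cis (2 * pi * real k / M)" for k
    by (simp add: w_def Complex.DeMoivre mult_ac)
  have "w ^ j \<noteq> w ^ l"
    using Complex.bij_betw_roots_unity[OF M] assms unfolding pow
    by (auto simp: bij_betw_def inj_on_def)
  have wM: "w ^ M = 1" using M by (simp add: pow)
  have cnj: "w ^ l * cnj (w ^ l) = 1"
    by (simp add: pow flip: complex_norm_square)
  define S where "S = (\<Sum>z | z ^ M = 1. z ^ j * cnj (z ^ l))"
  have w0: "w \<noteq> 0" by (simp add: w_def)
  have "S = (\<Sum>z | z ^ M = 1. (w * z) ^ j * cnj ((w * z) ^ l))"
    unfolding S_def
    by (rule sum.reindex_bij_witness[of _ "\<lambda>z. w * z" "\<lambda>z. z / w"])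
       (use w0 wM in \<open>auto simp: power_mult_distrib power_divide\<close>)
  also have "\<dots> = w ^ j * cnj (w ^ l) * S"
    by (simp add: S_def power_mult_distrib sum_distrib_left mult_ac)
  finally have "(1 - w ^ j * cnj (w ^ l)) * S = 0" by (simp add: algebra_simps)
  moreover have "w ^ j * cnj (w ^ l) \<noteq> 1"
    using \<open>w ^ j \<noteq> w ^ l\<close> cnj by (metis mult.commute mult.left_commute mult_1_right)
  ultimately show ?thesis by (simp add: S_def)
qed

text \<open>
  The discrete form of Parseval's identity on the circle. The condition \<open>d < M\<close> makes the
  characters \<open>z \<mapsto> z\<^sup>j\<close> with \<open>j \<le> d\<close> pairwise orthogonal.
\<close>
lemma parseval_roots_unity:
  fixes a :: "nat \<Rightarrow> complex"
  assumes "d < M"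
  shows "(\<Sum>z | z ^ M = 1. (cmod (\<Sum>j\<le>d. a j * z ^ j))\<^sup>2) = M * (\<Sum>j\<le>d. (cmod (a j))\<^sup>2)"
proof -
  have M: "M > 0" using assms by simp
  have diag: "(\<Sum>z | z ^ M = 1. z ^ j * cnj (z ^ l)) = (if j = l then of_nat M else 0 :: complex)"
    if "j \<le> d" "l \<le> d" for j l
  proof (cases "j = l")
    case True
    have "z ^ j * cnj (z ^ l) = 1" if "z ^ M = 1" for z :: complex
    proof -
      have "cmod z ^ M = 1" using that by (metis norm_one norm_power)
      then have "cmod z = 1" using M using power_eq_imp_eq_base[of "cmod z" M 1] by simp
      then have "z * cnj z = 1" by (simp flip: complex_norm_square)
      then show ?thesis using True by (simp flip: power_mult_distrib)
    qed
    then show ?thesis using True M by (simp add: card_roots_unity_eq)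
  next
    case False
    then show ?thesis using that assms sum_roots_unity_orthogonal[of j M l] by simp
  qed
  have "complex_of_real (\<Sum>z | z ^ M = 1. (cmod (\<Sum>j\<le>d. a j * z ^ j))\<^sup>2)
      = (\<Sum>z | z ^ M = 1. \<Sum>j\<le>d. \<Sum>l\<le>d. a j * cnj (a l) * (z ^ j * cnj (z ^ l)))"
    unfolding of_real_sum complex_norm_square cnj_sum sum_product
    by (intro sum.cong refl) (simp add: mult_ac)
  also have "\<dots> = (\<Sum>j\<le>d. \<Sum>z | z ^ M = 1. \<Sum>l\<le>d. a j * cnj (a l) * (z ^ j * cnj (z ^ l)))"
    by (rule sum.swap)
  also have "\<dots> = (\<Sum>j\<le>d. \<Sum>l\<le>d. a j * cnj (a l) * (\<Sum>z | z ^ M = 1. z ^ j * cnj (z ^ l)))"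
    unfolding sum_distrib_left by (intro sum.cong refl sum.swap)
  also have "\<dots> = (\<Sum>j\<le>d. \<Sum>l\<le>d. if j = l then a j * cnj (a j) * of_nat M else 0)"
    by (intro sum.cong refl) (simp add: diag del: complex_cnj_power)
  also have "\<dots> = of_real (M * (\<Sum>j\<le>d. (cmod (a j))\<^sup>2))"
    by (simp only: of_real_mult of_real_sum complex_norm_square sum_distrib_left of_real_of_nat_eq)
       (simp add: mult_ac)
  finally show ?thesis by (simp only: of_real_eq_iff)
qed

lemma poly_eq_prod_proots:
  fixes p :: "complex poly"
  assumes "poly p 0 \<noteq> 0"
  shows "poly p x = poly p 0 * (\<Prod>z\<in>#proots p. 1 - x / z)"
proof -
  have p: "p \<noteq> 0" using assms by auto
  have eq: "poly p y = lead_coeff p * (\<Prod>z\<in>#proots p. y - z)" for y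
    by (subst complex_poly_decompose_multiset[of p, symmetric])
       (simp add: poly_prod_mset)
  have factor: "(\<Prod>z\<in>#Z. x - z) = (\<Prod>z\<in>#Z. 0 - z) * (\<Prod>z\<in>#Z. 1 - x / z)"
    if "0 \<notin># Z" for Z
    using that by (induction Z) (auto simp: field_simps)
  have "0 \<notin># proots p" using p assms by simp
  from factor[OF this] show ?thesis unfolding eq[of x] eq[of 0] by (simp only: mult.assoc)
qed

text \<open>
  Each linear factor \<open>1 - x w / z\<close> is multiplied over the roots of unity \<open>w\<close> separately, which
  turns \<open>x / z\<close> into its \<open>M\<close>-th power.
\<close>
lemma prod_poly_roots_unity:
  fixes p :: "complex poly"
  assumes "poly p 0 \<noteq> 0" "M > 0"
  shows "(\<Prod>w | w ^ M = 1. poly p (x * w)) = poly p 0 ^ M * (\<Prod>z\<in>#proots p. 1 - (x / z) ^ M)"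
proof -
  have "(\<Prod>w | w ^ M = 1. \<Prod>z\<in>#Z. 1 - x * w / z) = (\<Prod>z\<in>#Z. 1 - (x / z) ^ M)" for Z
    by (induction Z)
       (use prod_one_minus_roots_unity[OF assms(2), of "x / _"] in \<open>simp_all add: prod.distrib\<close>)
  then show ?thesis
    by (subst poly_eq_prod_proots[OF assms(1)])
       (simp add: prod.distrib card_roots_unity_eq assms(2))
qed

section \<open>A discrete Landau inequality\<close>

text \<open>
  Up to the factor \<open>2\<close>, which disappears on taking \<open>M\<close>-th roots, the modulus of \<open>1 - w\<^sup>M\<close> is at
  least that of its dominant term. On the unit circle there is no dominant term and \<open>1 - w\<^sup>M\<close> can vanish.
\<close>
lemma eventually_max_power_le:
  fixes w :: complex
  assumes "cmod w \<noteq> 1"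
  shows "\<forall>\<^sub>F M in sequentially. max 1 (cmod w) ^ M \<le> 2 * cmod (1 - w ^ M)"
proof (cases "cmod w < 1")
  case True
  then have "(\<lambda>M. cmod w ^ M) \<longlonglongrightarrow> 0" by (intro LIMSEQ_power_zero) simp
  then have "\<forall>\<^sub>F M in sequentially. cmod w ^ M < 1 / 2"
    by (rule order_tendstoD) simp
  then show ?thesis
  proof eventually_elim
    case (elim M)
    have "1 - cmod w ^ M \<le> cmod (1 - w ^ M)"
      using norm_triangle_ineq2[of 1 "w ^ M"] by (simp add: norm_power)
    then show ?case using True elim by (simp add: max_def)
  qed
next
  case False
  then have w: "cmod w > 1" using assms by simp
  then obtain K where "2 < cmod w ^ K"
    using real_arch_pow by blast
  then have "2 \<le> cmod w ^ M" if "M \<ge> K" for M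
  proof -
    have "cmod w ^ K \<le> cmod w ^ M" by (rule power_increasing) (use that w in auto)
    with \<open>2 < cmod w ^ K\<close> show ?thesis by linarith
  qed
  then have "\<forall>\<^sub>F M in sequentially. 2 \<le> cmod w ^ M"
    by (rule eventually_sequentiallyI)
  then show ?thesis
  proof eventually_elim
    case (elim M)
    have "cmod w ^ M - 1 \<le> cmod (1 - w ^ M)"
      using norm_triangle_ineq2[of "w ^ M" 1] by (simp add: norm_power norm_minus_commute)
    then show ?case using False elim by (simp add: max_def)
  qed
qed

text \<open>
  The constant \<open>C\<close> is independent of \<open>M\<close>, so it does not survive taking \<open>M\<close>-th roots.
\<close>
lemma le_of_power_le_const_mult_power:
  fixes a b C :: real
  assumes "a \<ge> 0" "b \<ge> 0" and ev: "\<forall>\<^sub>F M in sequentially. a ^ M \<le> C * b ^ M"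
  shows "a \<le> b"
proof (rule ccontr)
  assume "\<not> a \<le> b"
  then have ab: "b < a" by simp
  then have a: "a > 0" using assms by simp
  have "(\<lambda>M. C * (b / a) ^ M) \<longlonglongrightarrow> C * 0"
    using ab assms a by (intro tendsto_mult tendsto_const LIMSEQ_power_zero) simp
  then have "\<forall>\<^sub>F M in sequentially. C * (b / a) ^ M < 1"
    by (intro order_tendstoD(2)) auto
  with ev have "\<forall>\<^sub>F M in sequentially. False"
  proof eventually_elim
    case (elim M)
    then show False using a by (simp add: power_divide field_simps)
  qed
  then show False by simp
qed

lemma prod_mset_nonneg_real:
  fixes f :: "'a \<Rightarrow> real"
  shows "(\<And>z. z \<in># Z \<Longrightarrow> 0 \<le> f z) \<Longrightarrow> 0 \<le> (\<Prod>z\<in>#Z. f z)"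
  by (induction Z) auto

text \<open>
  The lower half of Jensen's formula for a circle that carries no root. Bounding every factor
  \<open>1 - (r/z)\<^sup>M\<close> from below costs one factor \<open>2\<close> per root, hence a constant that does not depend on \<open>M\<close>.
\<close>
lemma landau_generic_radius:
  fixes p :: "complex poly"
  assumes p0: "poly p 0 \<noteq> 0" and r: "r > 0" and B: "B \<ge> 0"
    and generic: "\<And>z. poly p z = 0 \<Longrightarrow> cmod z \<noteq> r"
    and bound: "\<forall>\<^sub>F M in sequentially. (\<Prod>w | w ^ M = 1. cmod (poly p (of_real r * w))) \<le> B ^ M"
  shows "cmod (poly p 0) * (\<Prod>z\<in>#proots p. max 1 (r / cmod z)) \<le> B"
proof -
  have p: "p \<noteq> 0" using p0 by auto
  have "\<exists>C\<ge>0. \<forall>\<^sub>F M in sequentially.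
     (\<Prod>z\<in>#Z. max 1 (r / cmod z)) ^ M \<le> C * cmod (\<Prod>z\<in>#Z. 1 - (of_real r / z) ^ M)"
    if "\<And>z. z \<in># Z \<Longrightarrow> cmod z \<noteq> r" for Z
    using that
  proof (induction Z)
    case empty
    show ?case by (intro exI[of _ 1]) simp
  next
    case (add z Z)
    then obtain C where C: "C \<ge> 0" "\<forall>\<^sub>F M in sequentially.
     (\<Prod>z\<in>#Z. max 1 (r / cmod z)) ^ M \<le> C * cmod (\<Prod>z\<in>#Z. 1 - (of_real r / z) ^ M)"
      by auto
    have "cmod (of_real r / z) \<noteq> 1"
      using add.prems[of z] r by (auto simp: norm_divide field_simps split: if_splits)
    from C(2) eventually_max_power_le[OF this]
    have "\<forall>\<^sub>F M in sequentially. (\<Prod>z\<in>#add_mset z Z. max 1 (r / cmod z)) ^ M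
        \<le> (2 * C) * cmod (\<Prod>z\<in>#add_mset z Z. 1 - (of_real r / z) ^ M)"
    proof eventually_elim
      case (elim M)
      have "max 1 (cmod (of_real r / z)) ^ M * (\<Prod>z\<in>#Z. max 1 (r / cmod z)) ^ M
         \<le> 2 * cmod (1 - (of_real r / z) ^ M) * (C * cmod (\<Prod>z\<in>#Z. 1 - (of_real r / z) ^ M))"
        using elim by (intro mult_mono) (auto intro!: zero_le_power prod_mset_nonneg_real)
      then show ?case using r by (simp add: power_mult_distrib norm_mult norm_divide mult_ac)
    qed
    then show ?case using C(1) by (intro exI[of _ "2 * C"]) simp
  qed
  from this[of "proots p"] obtain C where C: "C \<ge> 0" "\<forall>\<^sub>F M in sequentially.
     (\<Prod>z\<in>#proots p. max 1 (r / cmod z)) ^ M \<le> C * cmod (\<Prod>z\<in>#proots p. 1 - (of_real r / z) ^ M)"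
    using generic p by auto
  have ev: "\<forall>\<^sub>F M in sequentially.
     (cmod (poly p 0) * (\<Prod>z\<in>#proots p. max 1 (r / cmod z))) ^ M \<le> C * B ^ M"
    using bound C(2) eventually_gt_at_top[of 0]
  proof eventually_elim
    case (elim M)
    have "(cmod (poly p 0) * (\<Prod>z\<in>#proots p. max 1 (r / cmod z))) ^ M
       \<le> cmod (poly p 0) ^ M * (C * cmod (\<Prod>z\<in>#proots p. 1 - (of_real r / z) ^ M))"
      unfolding power_mult_distrib using elim by (intro mult_left_mono) auto
    also have "\<dots> = C * cmod (\<Prod>w | w ^ M = 1. poly p (of_real r * w))"
      unfolding prod_poly_roots_unity[OF p0 elim(3)] by (simp add: norm_mult norm_power)
    also have "\<dots> \<le> C * B ^ M"
      using elim(1) C(1) by (intro mult_left_mono) (auto simp: prod_norm)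
    finally show ?case .
  qed
  have "0 \<le> cmod (poly p 0) * (\<Prod>z\<in>#proots p. max 1 (r / cmod z))"
    by (intro mult_nonneg_nonneg prod_mset_nonneg_real) auto
  then show ?thesis
    by (rule le_of_power_le_const_mult_power[OF _ B ev])
qed

text \<open>
  Only finitely many radii are excluded from the generic case, and both sides of the inequality are
  continuous in the radius. The radius of interest is a tropical root, which may well be the modulus
  of an eigenvalue.
\<close>
lemma landau_inequality:
  fixes p :: "complex poly" and B :: "real \<Rightarrow> real"
  assumes p0: "poly p 0 \<noteq> 0" and r: "r > 0"
    and B: "\<And>x. x > 0 \<Longrightarrow> B x \<ge> 0" and cont: "continuous_on {0<..} B"
    and bound: "\<And>x. x > 0 \<Longrightarrow> \<forall>\<^sub>F M in sequentially. (\<Prod>w | w ^ M = 1. cmod (poly p (of_real x * w))) \<le> B x ^ M"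
  shows "cmod (poly p 0) * (\<Prod>z\<in>#proots p. max 1 (r / cmod z)) \<le> B r"
proof -
  have p: "p \<noteq> 0" using p0 by auto
  have tend: "((\<lambda>x. \<Prod>z\<in>#Z. max 1 (x / cmod z)) \<longlongrightarrow> (\<Prod>z\<in>#Z. max 1 (r / cmod z))) (at r)" 
    if "0 \<notin># Z" for Z :: "complex multiset"
    using that by (induction Z) (auto intro!: tendsto_intros)
  have L: "((\<lambda>x. cmod (poly p 0) * (\<Prod>z\<in>#proots p. max 1 (x / cmod z))) \<longlongrightarrow>
      cmod (poly p 0) * (\<Prod>z\<in>#proots p. max 1 (r / cmod z))) (at r)"
    by (intro tendsto_mult tendsto_const tend) (use p p0 in simp)
  have R: "(B \<longlongrightarrow> B r) (at r)"
    using cont r by (simp add: continuous_on_eq_continuous_at isCont_def)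
  have "finite (cmod ` {z. poly p z = 0})"
    using poly_roots_finite[OF p] by simp
  then have "\<forall>\<^sub>F x in at r. x \<notin> cmod ` {z. poly p z = 0}"
  proof -
    have "\<forall>\<^sub>F x in at r. x \<in> - (cmod ` {z. poly p z = 0} - {r}) - {r}"
    proof (rule eventually_at_in_open)
      show "open (- (cmod ` {z. poly p z = 0} - {r}))"
        using \<open>finite _\<close> by (intro open_Compl finite_imp_closed) auto
    qed simp
    then show ?thesis by eventually_elim auto
  qed
  moreover have "\<forall>\<^sub>F x in at r. x \<in> {0<..} - {r}"
    by (rule eventually_at_in_open) (use r in auto)
  ultimately have "\<forall>\<^sub>F x in at r. cmod (poly p 0) * (\<Prod>z\<in>#proots p. max 1 (x / cmod z)) \<le> B x"
  proof eventually_elim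
    case (elim x)
    then show ?case by (intro landau_generic_radius p0 B bound) auto
  qed
  then show ?thesis
    by (intro tendsto_le[OF _ R L]) auto
qed

section \<open>The determinant of a matrix polynomial on a circle\<close>

text \<open>
  Parseval's identity applied to each entry of the matrix polynomial.
\<close>
lemma normalized_frobenius_mean:
  fixes C :: "nat \<Rightarrow> complex^'n^'n"
  assumes "d < M"
  shows "(\<Sum>w | w ^ M = 1. (normalized_frobenius (\<Sum>j\<le>d. matrix_scale (w ^ j) (C j)))\<^sup>2)
    = M * (\<Sum>j\<le>d. (normalized_frobenius (C j))\<^sup>2)"
proof -
  have entry: "(\<Sum>w | w ^ M = 1. (cmod ((\<Sum>j\<le>d. matrix_scale (w ^ j) (C j)) $ a $ b))\<^sup>2)
      = M * (\<Sum>j\<le>d. (cmod (C j $ a $ b))\<^sup>2)" for a b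
    using parseval_roots_unity[OF assms, of "\<lambda>j. C j $ a $ b"]
    by (simp add: matrix_scale_def mult.commute)
  have "(\<Sum>w | w ^ M = 1. (normalized_frobenius (\<Sum>j\<le>d. matrix_scale (w ^ j) (C j)))\<^sup>2)
     = (\<Sum>w | w ^ M = 1. \<Sum>a\<in>UNIV. \<Sum>b\<in>UNIV. (cmod ((\<Sum>j\<le>d. matrix_scale (w ^ j) (C j)) $ a $ b))\<^sup>2) / CARD('n)"
    by (simp only: normalized_frobenius_square sum_divide_distrib)
  also have "(\<Sum>w | w ^ M = 1. \<Sum>a\<in>UNIV. \<Sum>b\<in>UNIV. (cmod ((\<Sum>j\<le>d. matrix_scale (w ^ j) (C j)) $ a $ b))\<^sup>2)
     = (\<Sum>a\<in>UNIV. \<Sum>b\<in>UNIV. M * (\<Sum>j\<le>d. (cmod (C j $ a $ b))\<^sup>2))"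
    by (subst sum.swap, intro sum.cong refl, subst sum.swap) (simp only: entry)
  also have "\<dots> = M * (\<Sum>j\<le>d. \<Sum>a\<in>UNIV. \<Sum>b\<in>UNIV. (cmod (C j $ a $ b))\<^sup>2)"
    unfolding sum_distrib_left[symmetric] 
    by (subst (2) sum.swap, subst (1) sum.swap) simp
  finally show ?thesis
    by (simp only: normalized_frobenius_square sum_divide_distrib[symmetric] times_divide_eq_right)
qed

lemma matrix_sandwich_sum:
  fixes Q Q' :: "complex^'n^'n"
  shows "Q ** (\<Sum>j\<in>S. matrix_scale (x j) (A j)) ** Q' = (\<Sum>j\<in>S. matrix_scale (x j) (Q ** A j ** Q'))"
proof (induction S rule: infinite_finite_induct)
  case (insert j S)
  have "Q ** matrix_scale z B ** Q' = matrix_scale z (Q ** B ** Q')" for z and B :: "complex^'n^'n"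
    by (simp add: matrix_scale_def matrix_matrix_mult_def vec_eq_iff sum_distrib_left sum_distrib_right mult_ac)
  moreover have "(B + B') ** Q' = B ** Q' + B' ** Q'" for B B' :: "complex^'n^'n"
    by (simp add: matrix_matrix_mult_def vec_eq_iff sum.distrib distrib_right)
  ultimately show ?case
    using insert by (simp add: matrix_add_ldistrib)
qed (simp_all add: matrix_matrix_mult_def vec_eq_iff)

lemma tropical_monomial_le:
  "j \<le> degree P \<Longrightarrow> N (coeff P j) * x ^ j \<le> tropical_poly N P x"
  unfolding tropical_poly_def by (intro Max_ge) auto

lemma sum_le_mon_mult:
  fixes f :: "nat \<Rightarrow> real"
  assumes "\<And>j. j \<le> degree P \<Longrightarrow> coeff P j = 0 \<Longrightarrow> f j = 0"
    and "\<And>j. j \<le> degree P \<Longrightarrow> f j \<le> b"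
  shows "(\<Sum>j\<le>degree P. f j) \<le> real (mon P) * b"
proof -
  have "(\<Sum>j\<le>degree P. f j) = (\<Sum>j\<in>{j \<in> {0..degree P}. coeff P j \<noteq> 0}. f j)"
    by (rule sum.mono_neutral_right) (auto intro: assms(1))
  also have "\<dots> \<le> real (mon P) * b"
    unfolding mon_def by (rule sum_bounded_above) (auto intro: assms(2))
  finally show ?thesis .
qed

lemma norm_matpoly_le:
  fixes P :: "(complex^'n^'n) poly"
  assumes N: "is_matrix_norm N"
  shows "N (\<Sum>j\<le>degree P. matrix_scale (z ^ j) (coeff P j)) \<le> real (mon P) * tropical_poly N P (cmod z)"
proof -
  have zero: "N 0 = 0" and sc: "\<And>z A. N (matrix_scale z A) = cmod z * N A"
    and tri: "\<And>A B. N (A + B) \<le> N A + N B"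
    using N by (simp_all add: is_matrix_norm_def)
  have "N (\<Sum>j\<in>S. f j) \<le> (\<Sum>j\<in>S. N (f j))" for S and f :: "nat \<Rightarrow> complex^'n^'n"
  proof (induction S rule: infinite_finite_induct)
    case (insert j S)
    then show ?case using tri[of "f j" "sum f S"] by simp
  qed (simp_all add: zero)
  then have "N (\<Sum>j\<le>degree P. matrix_scale (z ^ j) (coeff P j))
     \<le> (\<Sum>j\<le>degree P. N (matrix_scale (z ^ j) (coeff P j)))" .
  also have "\<dots> \<le> real (mon P) * tropical_poly N P (cmod z)"
    by (rule sum_le_mon_mult)
       (use tropical_monomial_le[of _ P N "cmod z"] in \<open>auto simp: sc zero norm_power mult.commute\<close>)
  finally show ?thesis .
qed

lemma tropical_poly_nonneg:
  assumes "is_matrix_norm N"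
  shows "0 \<le> tropical_poly N P x"
  using assms tropical_monomial_le[of 0 P N x] by (auto simp: is_matrix_norm_def intro: order_trans)

text \<open>
  Here the bound holds pointwise on the circle. It is stated for the product over the roots of unity
  so that both hypotheses on the norm feed the same argument.
\<close>
lemma prod_det_matpoly_le_A1:
  fixes P :: "(complex^'n^'n) poly"
  assumes N: "is_matrix_norm N" and A1: "norm_A1 N" and x: "x > 0" and M: "M > 0"
  shows "(\<Prod>w | w ^ M = 1. cmod (poly (det_matpoly P) (of_real x * w)))
    \<le> ((real (mon P) * tropical_poly N P x) ^ CARD('n)) ^ M"
proof -
  have "cmod (poly (det_matpoly P) (of_real x * w)) \<le> (real (mon P) * tropical_poly N P x) ^ CARD('n)"
    if "w ^ M = 1" for w
  proof -
    have "cmod w ^ M = 1" using that by (metis norm_one norm_power)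
    then have w: "cmod w = 1" using M power_eq_imp_eq_base[of "cmod w" M 1] by simp
    let ?S = "\<Sum>j\<le>degree P. matrix_scale ((of_real x * w) ^ j) (coeff P j)"
    have "cmod (det ?S) \<le> N ?S ^ CARD('n)"
      using A1 by (auto simp: norm_A1_def)
    also have "\<dots> \<le> (real (mon P) * tropical_poly N P (cmod (of_real x * w))) ^ CARD('n)"
      using N by (intro power_mono norm_matpoly_le) (auto simp: is_matrix_norm_def)
    also have "cmod (of_real x * w) = x" using x w by (simp add: norm_mult)
    finally show ?thesis by (simp only: poly_det_matpoly)
  qed
  then have "(\<Prod>w | w ^ M = 1. cmod (poly (det_matpoly P) (of_real x * w)))
     \<le> (\<Prod>w\<in>{w::complex. w ^ M = 1}. (real (mon P) * tropical_poly N P x) ^ CARD('n))"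
    by (intro prod_mono) auto
  then show ?thesis using M by (simp add: card_roots_unity_eq)
qed

text \<open>
  Bounding the norm pointwise on the circle would give \<open>mon P\<close> instead of its square root. The
  geometric mean over the roots of unity of the squared Frobenius norm is at most its arithmetic mean, which by Parseval's identity is a sum of squares of the norms of the coefficients;
  bounding the sum of squares by its \<open>mon P\<close> nonzero terms leaves only a square root of \<open>mon P\<close>.
\<close>
lemma prod_det_matpoly_le_A2:
  fixes P :: "(complex^'n^'n) poly"
  assumes N: "is_matrix_norm N" and A2: "norm_A2 N" and x: "x > 0" and M: "M > degree P"
  shows "(\<Prod>w | w ^ M = 1. cmod (poly (det_matpoly P) (of_real x * w)))
    \<le> ((sqrt (real (mon P)) * tropical_poly N P x) ^ CARD('n)) ^ M"
proof -
  have M0: "M > 0" using M by simp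
  obtain Q Q' where Q: "det Q = 1" "det Q' = 1" "\<And>A. normalized_frobenius (Q ** A ** Q') \<le> N A"
    using A2 by (auto simp: norm_A2_def)
  define C where "C j = Q ** matrix_scale (of_real x ^ j) (coeff P j) ** Q'" for j
  define B where "B w = (\<Sum>j\<le>degree P. matrix_scale (w ^ j) (C j))" for w
  let ?T = "tropical_poly N P x"
  have det: "poly (det_matpoly P) (of_real x * w) = det (B w)" for w
  proof -
    have "(\<Sum>j\<le>degree P. matrix_scale ((of_real x * w) ^ j) (coeff P j))
       = (\<Sum>j\<le>degree P. matrix_scale (w ^ j) (matrix_scale (of_real x ^ j) (coeff P j)))"
      by (intro sum.cong) (auto simp: matrix_scale_def vec_eq_iff power_mult_distrib mult_ac)
    then have "B w = Q ** (\<Sum>j\<le>degree P. matrix_scale ((of_real x * w) ^ j) (coeff P j)) ** Q'"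
      by (simp add: B_def C_def matrix_sandwich_sum)
    then show ?thesis
      by (simp add: poly_det_matpoly det_mul Q)
  qed
  have C: "(normalized_frobenius (C j))\<^sup>2 \<le> (N (coeff P j) * x ^ j)\<^sup>2" for j
  proof -
    have "normalized_frobenius (C j) \<le> N (matrix_scale (of_real x ^ j) (coeff P j))"
      unfolding C_def by (rule Q(3))
    also have "\<dots> = N (coeff P j) * x ^ j"
      using N x by (simp add: is_matrix_norm_def norm_power)
    finally show ?thesis
      by (intro power_mono) (auto simp: normalized_frobenius_def intro!: divide_nonneg_nonneg sum_nonneg)
  qed
  have "(\<Sum>j\<le>degree P. (normalized_frobenius (C j))\<^sup>2) \<le> real (mon P) * ?T\<^sup>2"
  proof (rule sum_le_mon_mult)
    fix j assume j: "j \<le> degree P"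
    have "0 \<le> N (coeff P j) * x ^ j" using N x by (simp add: is_matrix_norm_def)
    then have "(N (coeff P j) * x ^ j)\<^sup>2 \<le> ?T\<^sup>2"
      using tropical_monomial_le[OF j] by (intro power_mono) auto
    with C[of j] show "(normalized_frobenius (C j))\<^sup>2 \<le> ?T\<^sup>2" by simp
    assume "coeff P j = 0"
    then have "N (coeff P j) = 0" using N by (simp add: is_matrix_norm_def)
    with C[of j] show "(normalized_frobenius (C j))\<^sup>2 = 0" by simp
  qed
  also have "\<dots> = (sqrt (real (mon P)) * ?T)\<^sup>2" by (simp add: power_mult_distrib)
  finally have S: "(\<Sum>j\<le>degree P. (normalized_frobenius (C j))\<^sup>2) \<le> (sqrt (real (mon P)) * ?T)\<^sup>2" .
  have fin: "finite {w::complex. w ^ M = 1}" using M0 by (intro finite_roots_unity) simp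
  have ne: "{w::complex. w ^ M = 1} \<noteq> {}" by (auto intro: exI[of _ 1])
  have "(\<Prod>w | w ^ M = 1. cmod (poly (det_matpoly P) (of_real x * w)))\<^sup>2
     = (\<Prod>w | w ^ M = 1. (cmod (det (B w)))\<^sup>2)"
    by (simp add: det prod_power_distrib)
  also have "\<dots> \<le> (\<Prod>w | w ^ M = 1. ((normalized_frobenius (B w))\<^sup>2) ^ CARD('n))"
    by (intro prod_mono) (auto intro: det_le_normalized_frobenius)
  also have "\<dots> = (\<Prod>w | w ^ M = 1. (normalized_frobenius (B w))\<^sup>2) ^ CARD('n)"
    by (simp only: prod_power_distrib)
  also have "\<dots> \<le> (((\<Sum>w | w ^ M = 1. (normalized_frobenius (B w))\<^sup>2) / M) ^ M) ^ CARD('n)"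
    using prod_le_power_mean[OF fin ne, of "\<lambda>w. (normalized_frobenius (B w))\<^sup>2"] M0
    by (intro power_mono) (auto intro: prod_nonneg simp: card_roots_unity_eq)
  also have "(\<Sum>w | w ^ M = 1. (normalized_frobenius (B w))\<^sup>2) / M = (\<Sum>j\<le>degree P. (normalized_frobenius (C j))\<^sup>2)"
    unfolding B_def normalized_frobenius_mean[OF M] using M0 by simp
  also have "(\<dots> ^ M) ^ CARD('n) \<le> (((sqrt (real (mon P)) * ?T)\<^sup>2) ^ M) ^ CARD('n)"
    by (intro power_mono S) (simp_all add: sum_nonneg)
  also have "\<dots> = (((sqrt (real (mon P)) * ?T) ^ CARD('n)) ^ M)\<^sup>2"
    by (simp only: power_mult[symmetric] mult.commute mult.left_commute)
  finally show ?thesis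
    by (rule power2_le_imp_le) (use tropical_poly_nonneg[OF N] in simp)
qed

section \<open>Listings of eigenvalues and tropical roots\<close>

text \<open>
  In \<^typ>\<open>ereal\<close> the product \<open>\<infinity> * 0\<close> is \<open>0\<close>, so an infinite factor makes the product infinite
  only when no factor vanishes.
\<close>
lemma prod_modulus_eq_infinity_or_finite:
  assumes "\<And>i. i \<in> I \<Longrightarrow> \<zeta> i \<noteq> Some 0" "finite I"
  shows "(\<Prod>i\<in>I. modulus (\<zeta> i)) = \<infinity> \<or>
    (\<forall>i\<in>I. \<zeta> i \<noteq> None) \<and> (\<Prod>i\<in>I. modulus (\<zeta> i)) = ereal (\<Prod>i\<in>I. cmod (the (\<zeta> i)))"
proof (cases "\<exists>i\<in>I. \<zeta> i = None")
  case True
  have "(\<Prod>i\<in>I. modulus (\<zeta> i)) = \<infinity>"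
    using assms True by (subst prod_PInf) (auto simp: modulus_def split: option.splits)
  then show ?thesis ..
next
  case False
  then have "(\<Prod>i\<in>I. modulus (\<zeta> i)) = (\<Prod>i\<in>I. ereal (cmod (the (\<zeta> i))))"
    by (intro prod.cong) (auto simp: modulus_def split: option.splits)
  then show ?thesis using False by (auto simp: prod_ereal)
qed

lemma ceiling_div_eq:
  assumes "0 < n" "n * m < i" "i \<le> n * Suc m"
  shows "nat \<lceil>real i / real n\<rceil> = Suc m"
proof -
  have "real (n * m) < real i" "real i \<le> real (n * Suc m)"
    using assms(2,3) by (simp_all only: of_nat_less_iff of_nat_le_iff)
  then have "\<lceil>real i / real n\<rceil> = int (Suc m)"
    using assms(1) by (intro ceiling_unique) (simp_all add: field_simps)
  then show ?thesis by simp
qed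

lemma prod_ceiling_blocks:
  fixes \<alpha> :: "nat \<Rightarrow> real"
  assumes "0 < n"
  shows "(\<Prod>i=1..n * m. \<alpha> (nat \<lceil>real i / real n\<rceil>)) = (\<Prod>j=1..m. \<alpha> j) ^ n"
proof (induction m)
  case (Suc m)
  have "{1..n * Suc m} = {1..n * m} \<union> {n * m + 1..n * Suc m}" by auto
  then have "(\<Prod>i=1..n * Suc m. \<alpha> (nat \<lceil>real i / real n\<rceil>))
     = (\<Prod>i=1..n * m. \<alpha> (nat \<lceil>real i / real n\<rceil>)) * (\<Prod>i=n * m + 1..n * Suc m. \<alpha> (nat \<lceil>real i / real n\<rceil>))"
    by (simp only:) (rule prod.union_disjoint, auto)
  also have "(\<Prod>i=n * m + 1..n * Suc m. \<alpha> (nat \<lceil>real i / real n\<rceil>)) = (\<Prod>i=n * m + 1..n * Suc m. \<alpha> (Suc m))"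
    by (intro prod.cong refl arg_cong[of _ _ \<alpha>] ceiling_div_eq[OF assms]) auto
  also have "\<dots> = \<alpha> (Suc m) ^ n" by (simp add: prod_constant)
  also have "(\<Prod>i=1..n * m. \<alpha> (nat \<lceil>real i / real n\<rceil>)) = (\<Prod>j=1..m. \<alpha> j) ^ n"
    by (rule Suc.IH)
  also have "(\<Prod>j=1..m. \<alpha> j) ^ n * \<alpha> (Suc m) ^ n = (\<Prod>j=1..Suc m. \<alpha> j) ^ n"
    by (simp add: power_mult_distrib)
  finally show ?case .
qed simp

text \<open>
  With \<open>0\<^sup>0 = 1\<close>, only the constant coefficient contributes at \<open>0\<close>.
\<close>
lemma tropical_poly_zero:
  assumes "is_matrix_norm N"
  shows "tropical_poly N P 0 = N (coeff P 0)"
  unfolding tropical_poly_def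
proof (rule Max_eqI)
  fix y assume "y \<in> (\<lambda>j. N (coeff P j) * 0 ^ j) ` {0..degree P}"
  then show "y \<le> N (coeff P 0)"
    using assms by (auto simp: is_matrix_norm_def power_0_left)
qed (auto intro: rev_image_eqI[of 0])

lemma tropical_roots_pos:
  assumes N: "is_matrix_norm N" and trop: "is_tropical_roots N P \<alpha>" and A0: "coeff P 0 \<noteq> 0"
    and j: "j \<in> {1..degree P}"
  shows "\<alpha> j > 0"
proof -
  have "tropical_poly N P 0 = N (coeff P (degree P)) * (\<Prod>j=1..degree P. max 0 (\<alpha> j))"
    using trop by (simp add: is_tropical_roots_def)
  moreover have "tropical_poly N P 0 \<noteq> 0"
    using N A0 by (simp add: tropical_poly_zero is_matrix_norm_def)
  ultimately have "(\<Prod>j=1..degree P. max 0 (\<alpha> j)) \<noteq> 0" by auto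
  then have "max 0 (\<alpha> j) \<noteq> 0" using j by auto
  then show ?thesis by (auto simp: max_def split: if_splits)
qed

text \<open>
  The factors \<open>max x \<alpha>\<^sub>j\<close> with \<open>j > m\<close> take the same values at \<open>x = \<alpha>\<^sub>m\<close> as at \<open>x = 0\<close>. Comparing the
  factorizations at these two points eliminates the leading coefficient.
\<close>
lemma tropical_poly_at_root:
  assumes N: "is_matrix_norm N" and trop: "is_tropical_roots N P \<alpha>"
    and m: "m \<in> {1..degree P}"
  shows "tropical_poly N P (\<alpha> m) * (\<Prod>j=1..m. \<alpha> j) = N (coeff P 0) * \<alpha> m ^ m"
proof -
  let ?d = "degree P"
  have nonneg: "\<And>j. j \<in> {1..?d} \<Longrightarrow> 0 \<le> \<alpha> j" and mono: "mono_on {1..?d} \<alpha>"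
    and eq: "\<And>x. x \<ge> 0 \<Longrightarrow> tropical_poly N P x = N (coeff P ?d) * (\<Prod>j=1..?d. max x (\<alpha> j))"
    using trop by (auto simp: is_tropical_roots_def)
  have split: "(\<Prod>j=1..?d. f j) = (\<Prod>j=1..m. f j) * (\<Prod>j=m+1..?d. f j)" for f :: "nat \<Rightarrow> real"
  proof -
    have "{1..?d} = {1..m} \<union> {m+1..?d}" using m by auto
    then show ?thesis by (simp only:) (rule prod.union_disjoint, auto)
  qed
  have "(\<Prod>j=1..m. max (\<alpha> m) (\<alpha> j)) = (\<Prod>j=1..m. \<alpha> m)"
    using m by (intro prod.cong refl max_absorb1 mono_onD[OF mono]) auto
  moreover have "(\<Prod>j=m+1..?d. max (\<alpha> m) (\<alpha> j)) = (\<Prod>j=m+1..?d. \<alpha> j)"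
    using m by (intro prod.cong refl max_absorb2 mono_onD[OF mono]) auto
  ultimately have 1: "tropical_poly N P (\<alpha> m) = N (coeff P ?d) * (\<alpha> m ^ m * (\<Prod>j=m+1..?d. \<alpha> j))"
    using eq[of "\<alpha> m"] nonneg[OF m] unfolding split by simp
  have "(\<Prod>j=1..?d. max 0 (\<alpha> j)) = (\<Prod>j=1..?d. \<alpha> j)"
    using nonneg by (intro prod.cong refl max_absorb2) auto
  then have 2: "N (coeff P 0) = N (coeff P ?d) * ((\<Prod>j=1..m. \<alpha> j) * (\<Prod>j=m+1..?d. \<alpha> j))"
    using eq[of 0] tropical_poly_zero[OF N] unfolding split by simp
  show ?thesis unfolding 1 2 by (simp only: mult_ac)
qed

text \<open>
  All factors on the right-hand side are at least \<open>1\<close>, so omitting eigenvalues only decreases the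
  product; infinite eigenvalues contribute the factor \<open>1\<close>.
\<close>
lemma prod_listing_le_prod_proots:
  fixes P :: "(complex^'n^'n) poly"
  assumes listing: "eigenvalue_listing P \<zeta>" and r: "r > 0" and K: "K \<le> CARD('n) * degree P"
    and fin: "\<forall>i\<in>{1..K}. \<zeta> i \<noteq> None"
  shows "(\<Prod>i=1..K. r / cmod (the (\<zeta> i))) \<le> (\<Prod>z\<in>#proots (det_matpoly P). max 1 (r / cmod z))"
proof -
  \<comment> \<open>extending the factor to infinite eigenvalues by \<open>1\<close>, its limit as \<open>\<bar>z\<bar> \<rightarrow> \<infinity>\<close>\<close>
  define g where "g \<zeta> = (case \<zeta> of None \<Rightarrow> 1 | Some z \<Rightarrow> max 1 (r / cmod z))" for \<zeta>
  have g1: "1 \<le> g x" for x by (simp add: g_def split: option.split)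
  have "(\<Prod>i=1..K. r / cmod (the (\<zeta> i))) \<le> (\<Prod>i=1..K. g (\<zeta> i))"
  proof (rule prod_mono)
    fix i assume "i \<in> {1..K}"
    with fin obtain z where "\<zeta> i = Some z" by blast
    then show "0 \<le> r / cmod (the (\<zeta> i)) \<and> r / cmod (the (\<zeta> i)) \<le> g (\<zeta> i)"
      using r by (simp add: g_def)
  qed
  also have "\<dots> \<le> (\<Prod>i=1..CARD('n) * degree P. g (\<zeta> i))"
    using K g1 by (intro prod_mono2) (auto intro: order_trans[OF zero_le_one])
  also have "\<dots> = (\<Prod>x\<in>#eigenvalues_matpoly P. g x)"
  proof -
    have "eigenvalues_matpoly P = image_mset \<zeta> (mset_set {1..CARD('n) * degree P})"
      using listing by (simp add: eigenvalue_listing_def)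
    then show ?thesis
      by (simp add: prod_unfold_prod_mset image_mset.compositionality comp_def)
  qed
  also have "\<dots> = (\<Prod>z\<in>#proots (det_matpoly P). max 1 (r / cmod z))"
    by (simp add: eigenvalues_matpoly_def g_def image_mset.compositionality comp_def)
  finally show ?thesis .
qed

lemma poly_det_matpoly_0: "poly (det_matpoly P) 0 = det (coeff P 0)"
proof -
  have "(\<Sum>j\<le>degree P. matrix_scale (0 ^ j) (coeff P j)) = (\<Sum>j\<in>{0}. matrix_scale (0 ^ j) (coeff P j))"
    by (rule sum.mono_neutral_right) (auto simp: matrix_scale_def vec_eq_iff)
  also have "\<dots> = coeff P 0" by (simp add: matrix_scale_def vec_eq_iff)
  finally show ?thesis by (simp add: poly_det_matpoly)
qed

text \<open>
  Landau's inequality at the radius \<open>r = \<alpha>\<^sub>m\<close> with \<open>m = \<lceil>K/n\<rceil>\<close>. The first \<open>n m\<close> of the numbers \<open>\<alpha>\<^bsub>\<lceil>i/n\<rceil>\<^esub>\<close>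
  have the product \<open>(\<alpha>\<^sub>1 \<dots> \<alpha>\<^sub>m)\<^sup>n\<close>, and those of them beyond the \<open>K\<close>-th are equal to \<open>r\<close>; this is exactly
  what makes the powers of \<open>r\<close> cancel. The parameter \<open>L\<close> stands for \<open>mon P\<close> or its square root.
\<close>
lemma eigenvalue_product_bound:
  fixes P :: "(complex^'n^'n) poly"
  assumes N: "is_matrix_norm N"
    and det0: "det (coeff P 0) \<noteq> 0"
    and listing: "eigenvalue_listing P \<zeta>"
    and trop: "is_tropical_roots N P \<alpha>"
    and L: "L > 0"
    and bound: "\<And>x. x > 0 \<Longrightarrow> \<forall>\<^sub>F M in sequentially.
      (\<Prod>w | w ^ M = 1. cmod (poly (det_matpoly P) (of_real x * w)))
        \<le> ((L * tropical_poly N P x) ^ CARD('n)) ^ M"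
    and K: "K \<in> {1..CARD('n) * degree P}"
  shows "(\<Prod>i=1..K. modulus (\<zeta> i)) / ereal (\<Prod>i=1..K. \<alpha> (nat \<lceil>real i / real CARD('n)\<rceil>))
     \<ge> ereal (cmod (det (coeff P 0)) / N (coeff P 0) ^ CARD('n) * (1 / L) ^ CARD('n))"
proof -
  let ?n = "CARD('n)" and ?d = "degree P" and ?p = "det_matpoly P"
  let ?A = "\<lambda>i. \<alpha> (nat \<lceil>real i / real ?n\<rceil>)" and ?a = "N (coeff P 0)"
  have n: "?n > 0" by simp
  have A0: "coeff P 0 \<noteq> 0" using det0 det_0[unfolded mat_0] by metis
  then have a: "?a > 0" using N by (simp add: is_matrix_norm_def less_le)
  have p0: "poly ?p 0 \<noteq> 0" using det0 by (simp add: poly_det_matpoly_0)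
  \<comment> \<open>an integer form of \<open>\<lceil>K/n\<rceil>\<close>, valid because \<open>K \<ge> 1\<close>\<close>
  define m where "m = Suc ((K - 1) div ?n)"
  have Km: "?n * (m - 1) < K" "K \<le> ?n * m"
  proof -
    have "?n * ((K - 1) div ?n) + (K - 1) mod ?n + 1 = K" using K by simp
    moreover have "(K - 1) mod ?n < ?n" using n by (rule mod_less_divisor)
    ultimately show "?n * (m - 1) < K" "K \<le> ?n * m"
      unfolding m_def diff_Suc_1 mult_Suc_right by linarith+
  qed
  have m: "m \<in> {1..?d}"
  proof -
    have "?n * (m - 1) < ?n * ?d" by (rule less_le_trans[OF Km(1)]) (use K in simp)
    then have "m - 1 < ?d" by simp
    then show ?thesis by (auto simp: m_def)
  qed
  have ceil: "nat \<lceil>real i / real ?n\<rceil> = m" if "?n * (m - 1) < i" "i \<le> ?n * m" for i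
    using ceiling_div_eq[of ?n "m - 1" i] that n by (simp add: m_def)
  define r where "r = \<alpha> m"
  have pos: "\<alpha> j > 0" if "j \<in> {1..?d}" for j
    by (rule tropical_roots_pos[OF N trop A0 that])
  have r: "r > 0" unfolding r_def by (rule pos[OF m])
  define T where "T = (\<Prod>j=1..m. \<alpha> j)"
  define Y where "Y = (\<Prod>i=1..K. ?A i)"
  have T: "T > 0" unfolding T_def using m by (intro prod_pos) (auto intro!: pos)
  have YT: "Y * r ^ (?n * m - K) = T ^ ?n"
  proof -
    have "{1..?n * m} = {1..K} \<union> {K + 1..?n * m}" using Km by auto
    then have "(\<Prod>i=1..?n * m. ?A i) = Y * (\<Prod>i=K + 1..?n * m. ?A i)"
      unfolding Y_def by (simp only:) (rule prod.union_disjoint, auto)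
    also have "(\<Prod>i=K + 1..?n * m. ?A i) = (\<Prod>i=K + 1..?n * m. r)"
      unfolding r_def using Km by (intro prod.cong refl arg_cong[of _ _ \<alpha>] ceil) auto
    also have "\<dots> = r ^ (?n * m - K)" by simp
    finally show ?thesis using prod_ceiling_blocks[OF n, of \<alpha> m] by (simp add: T_def)
  qed
  have Y: "Y > 0"
  proof -
    have "Y * r ^ (?n * m - K) > 0" unfolding YT using T by simp
    then show ?thesis using r by (simp add: zero_less_mult_iff)
  qed
  have landau: "cmod (poly ?p 0) * (\<Prod>z\<in>#proots ?p. max 1 (r / cmod z)) \<le> (L * tropical_poly N P r) ^ ?n"
  proof (rule landau_inequality[OF p0 r _ _ bound])
    have "continuous_on {0<..} (\<lambda>x. (L * (N (coeff P ?d) * (\<Prod>j=1..?d. max x (\<alpha> j)))) ^ ?n)"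
      by (intro continuous_intros)
    then show "continuous_on {0<..} (\<lambda>x. (L * tropical_poly N P x) ^ ?n)"
      by (rule continuous_on_eq) (use trop in \<open>simp add: is_tropical_roots_def\<close>)
  qed (use L tropical_poly_nonneg[OF N] in \<open>auto\<close>)
  have nz: "\<zeta> i \<noteq> Some 0" if "i \<in> {1..K}" for i
  proof
    assume z: "\<zeta> i = Some 0"
    have eq: "image_mset \<zeta> (mset_set {1..?n * ?d}) = eigenvalues_matpoly P"
      using listing by (simp add: eigenvalue_listing_def)
    have "\<zeta> i \<in># image_mset \<zeta> (mset_set {1..?n * ?d})"
      using that K by auto
    then have "Some 0 \<in># eigenvalues_matpoly P"
      unfolding eq z .
    moreover have "?p \<noteq> 0" using p0 by auto
    ultimately show False using p0 by (auto simp: eigenvalues_matpoly_def split: if_splits)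
  qed
  let ?c = "cmod (det (coeff P 0)) / ?a ^ ?n * (1 / L) ^ ?n"
  have "(\<Prod>i=1..K. modulus (\<zeta> i)) = \<infinity> \<or>
      (\<forall>i\<in>{1..K}. \<zeta> i \<noteq> None) \<and> (\<Prod>i=1..K. modulus (\<zeta> i)) = ereal (\<Prod>i=1..K. cmod (the (\<zeta> i)))"
    by (rule prod_modulus_eq_infinity_or_finite[OF nz]) auto
  then show ?thesis
  proof (elim disjE conjE)
    assume "(\<Prod>i=1..K. modulus (\<zeta> i)) = \<infinity>"
    then show ?thesis using Y by (simp add: Y_def)
  next
    assume fin: "\<forall>i\<in>{1..K}. \<zeta> i \<noteq> None"
      and eq: "(\<Prod>i=1..K. modulus (\<zeta> i)) = ereal (\<Prod>i=1..K. cmod (the (\<zeta> i)))"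
    define Z where "Z = (\<Prod>i=1..K. cmod (the (\<zeta> i)))"
    have Z: "Z > 0"
      unfolding Z_def
    proof (rule prod_pos)
      fix i assume "i \<in> {1..K}"
      then show "0 < cmod (the (\<zeta> i))" using nz[of i] fin by (cases "\<zeta> i") force+
    qed
    have "cmod (det (coeff P 0)) * (r ^ K / Z) \<le> (L * tropical_poly N P r) ^ ?n"
    proof -
      have "r ^ K / Z = (\<Prod>i=1..K. r / cmod (the (\<zeta> i)))"
        by (simp add: Z_def prod_dividef)
      also have "\<dots> \<le> (\<Prod>z\<in>#proots ?p. max 1 (r / cmod z))"
        using K by (intro prod_listing_le_prod_proots listing r fin) auto
      finally have "cmod (poly ?p 0) * (r ^ K / Z) \<le> cmod (poly ?p 0) * (\<Prod>z\<in>#proots ?p. max 1 (r / cmod z))"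
        by (rule mult_left_mono) simp
      with landau show ?thesis by (simp add: poly_det_matpoly_0)
    qed
    then have "cmod (det (coeff P 0)) * r ^ K \<le> (L * tropical_poly N P r) ^ ?n * Z"
      using Z by (simp add: field_simps)
    then have "cmod (det (coeff P 0)) * r ^ K * T ^ ?n \<le> (L * tropical_poly N P r) ^ ?n * Z * T ^ ?n"
      using T by (intro mult_right_mono) auto
    also have "\<dots> = L ^ ?n * Z * (tropical_poly N P r * T) ^ ?n"
      by (simp add: power_mult_distrib)
    also have "tropical_poly N P r * T = ?a * r ^ m"
      unfolding r_def T_def by (rule tropical_poly_at_root[OF N trop m])
    also have "L ^ ?n * Z * (?a * r ^ m) ^ ?n = L ^ ?n * Z * ?a ^ ?n * r ^ (?n * m)"
      by (simp add: power_mult_distrib mult.commute[of ?n] flip: power_mult)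
    also have "cmod (det (coeff P 0)) * r ^ K * T ^ ?n = cmod (det (coeff P 0)) * Y * (r ^ K * r ^ (?n * m - K))"
      by (simp flip: YT)
    also have "r ^ K * r ^ (?n * m - K) = r ^ (?n * m)"
      using Km by (simp flip: power_add)
    finally have "cmod (det (coeff P 0)) * Y \<le> L ^ ?n * Z * ?a ^ ?n"
      using r by simp
    then have "?c \<le> Z / Y"
      using Y L a by (simp add: field_simps)
    then show ?thesis
      unfolding eq Z_def[symmetric] Y_def[symmetric] using Y by simp
  qed
qed

lemma mon_pos:
  assumes "coeff P 0 \<noteq> 0"
  shows "mon P > 0"
  unfolding mon_def using assms by (subst card_gt_0_iff) auto

section \<open>Moduli of eigenvalues and tropical roots\<close>

theorem theorem4p1:
  fixes P :: "(complex^'n^'n) poly"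
    and d :: nat
    and N :: "complex^'n^'n \<Rightarrow> real"
    and \<zeta> :: "nat \<Rightarrow> complex option"
    and \<alpha> \<alpha>bar :: "nat \<Rightarrow> real"
    and c :: real
  assumes "d \<ge> 1"
    and "degree P = d"
    and "is_matrix_norm N"
    and "norm_A1 N"
    and "det (coeff P 0) \<noteq> 0"
    and "c = cmod (det (coeff P 0)) / N (coeff P 0) ^ CARD('n)"
    and "eigenvalue_listing P \<zeta>"
    and "is_tropical_roots N P \<alpha>"
    and "\<And>K. K \<in> {1..CARD('n) * d} \<Longrightarrow> \<alpha>bar K = \<alpha> (nat \<lceil>real K / real CARD('n)\<rceil>)"
  shows "(\<forall>K\<in>{1..CARD('n) * d}.
            (\<Prod>i=1..K. modulus (\<zeta> i)) / ereal (\<Prod>i=1..K. \<alpha>bar i)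
              \<ge> ereal (c * (1 / real (mon P)) ^ CARD('n))) \<and>
         (\<forall>k\<in>{1..d}.
            (\<Prod>i=1..CARD('n) * k. modulus (\<zeta> i)) / ereal ((\<Prod>j=1..k. \<alpha> j) ^ CARD('n))
              \<ge> ereal (c * (1 / real (mon P)) ^ CARD('n))) \<and>
         (norm_A2 N \<longrightarrow>
            (\<forall>K\<in>{1..CARD('n) * d}.
               (\<Prod>i=1..K. modulus (\<zeta> i)) / ereal (\<Prod>i=1..K. \<alpha>bar i)
                 \<ge> ereal (c * (1 / sqrt (real (mon P))) ^ CARD('n))) \<and>
            (\<forall>k\<in>{1..d}.
               (\<Prod>i=1..CARD('n) * k. modulus (\<zeta> i)) / ereal ((\<Prod>j=1..k. \<alpha> j) ^ CARD('n))
                 \<ge> ereal (c * (1 / sqrt (real (mon P))) ^ CARD('n))))"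
proof -
  let ?n = "CARD('n)"
  let ?bound_K = "\<lambda>L. \<forall>K\<in>{1..?n * d}. (\<Prod>i=1..K. modulus (\<zeta> i)) / ereal (\<Prod>i=1..K. \<alpha>bar i)
      \<ge> ereal (c * (1 / L) ^ ?n)"
  let ?bound_k = "\<lambda>L. \<forall>k\<in>{1..d}. (\<Prod>i=1..?n * k. modulus (\<zeta> i)) / ereal ((\<Prod>j=1..k. \<alpha> j) ^ ?n)
      \<ge> ereal (c * (1 / L) ^ ?n)"
  have bounds: "?bound_K L \<and> ?bound_k L"
    if L: "L > 0" and ev: "\<And>x. x > 0 \<Longrightarrow> \<forall>\<^sub>F M in sequentially.
      (\<Prod>w | w ^ M = 1. cmod (poly (det_matpoly P) (of_real x * w)))
        \<le> ((L * tropical_poly N P x) ^ ?n) ^ M" for L :: real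
  proof -
    have main: "(\<Prod>i=1..K. modulus (\<zeta> i)) / ereal (\<Prod>i=1..K. \<alpha> (nat \<lceil>real i / real ?n\<rceil>))
      \<ge> ereal (c * (1 / L) ^ ?n)" if "K \<in> {1..?n * d}" for K
      unfolding assms(6)
      by (rule eigenvalue_product_bound[OF assms(3,5,7,8) L ev]) (use that assms(2) in auto)
    have "?bound_K L"
    proof
      fix K assume K: "K \<in> {1..?n * d}"
      then have "(\<Prod>i=1..K. \<alpha>bar i) = (\<Prod>i=1..K. \<alpha> (nat \<lceil>real i / real ?n\<rceil>))"
        by (intro prod.cong refl assms(9)) auto
      then show "(\<Prod>i=1..K. modulus (\<zeta> i)) / ereal (\<Prod>i=1..K. \<alpha>bar i) \<ge> ereal (c * (1 / L) ^ ?n)"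
        using main[OF K] by (simp only:)
    qed
    moreover have "?bound_k L"
    proof
      fix k assume "k \<in> {1..d}"
      then have "?n * k \<in> {1..?n * d}" by (auto simp: Suc_le_eq)
      from main[OF this]
      show "(\<Prod>i=1..?n * k. modulus (\<zeta> i)) / ereal ((\<Prod>j=1..k. \<alpha> j) ^ ?n) \<ge> ereal (c * (1 / L) ^ ?n)"
        by (simp only: prod_ceiling_blocks[OF zero_less_card_finite])
    qed
    ultimately show ?thesis ..
  qed
  have "coeff P 0 \<noteq> 0" using assms(5) det_0[unfolded mat_0] by metis
  then have mon: "mon P > 0" by (rule mon_pos)
  have "?bound_K (real (mon P)) \<and> ?bound_k (real (mon P))"
  proof (rule bounds)
    fix x :: real assume x: "x > 0"
    show "\<forall>\<^sub>F M in sequentially. (\<Prod>w | w ^ M = 1. cmod (poly (det_matpoly P) (of_real x * w)))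
        \<le> ((real (mon P) * tropical_poly N P x) ^ ?n) ^ M"
      using eventually_gt_at_top[of 0]
      by eventually_elim (rule prod_det_matpoly_le_A1[OF assms(3,4) x])
  qed (use mon in simp)
  moreover have "?bound_K (sqrt (real (mon P))) \<and> ?bound_k (sqrt (real (mon P)))" if "norm_A2 N"
  proof (rule bounds)
    fix x :: real assume x: "x > 0"
    show "\<forall>\<^sub>F M in sequentially. (\<Prod>w | w ^ M = 1. cmod (poly (det_matpoly P) (of_real x * w)))
        \<le> ((sqrt (real (mon P)) * tropical_poly N P x) ^ ?n) ^ M"
      using eventually_gt_at_top[of "degree P"]
      by eventually_elim (rule prod_det_matpoly_le_A2[OF assms(3) that x])
  qed (use mon in simp)
  ultimately show ?thesis by blast
qed

end
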